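(* Let $T$ be a finite tree, and let $T'$ be a connected minor of $T$. Then $\operatorname{th}_f(T') \le \operatorname{th}_f(T)$.
   Context: All graphs are finite and simple. Full forcing: given a graph $G$ and an initial set $B\subseteq V(G)$ of blue vertices (all other vertices are white), in each time step every white vertex that has a blue neighbor becomes blue. That is, $B^{(0)}=B$ and, for $k\ge 1$, $B^{(k)}$ is the set of vertices that become blue at time step $k$, i.e. the vertices not in $\bigcup_{i=0}^{k-1}B^{(i)}$ having a neighbor in $\bigcup_{i=0}^{k-1}B^{(i)}$. The full forcing propagation time $\operatorname{pt}_f(G;B)$ is the least $k\ge 0$ with $\bigcup_{i=0}^{k}B^{(i)}=V(G)$, and is $\infty$ if there is no such $k$. The full throttling number of $B$ is $\operatorname{th}_f(G;B)=|B|+\operatorname{pt}_f(G;B)$, and the full throttling number of $G$ is $\operatorname{th}_f(G)=\min_{B\subseteq V(G)}\operatorname{th}_f(G;B)$. A connected minor of a graph is a minor of the graph (with nonempty vertex set) that is a connected graph. *)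

theory Defs
  imports "Graph_Theory.Graph_Theory" "HOL-Library.Extended_Nat"
begin

text \<open>
  Finite simple graphs are represented by the locale \<open>pair_graph\<close> of Graph_Theory: finite,
  loop-free, symmetric digraphs whose arcs are ordered pairs of vertices; an undirected edge
  is the pair of arcs \<open>(u, v)\<close>, \<open>(v, u)\<close>.  The library's \<open>connected\<close> requires a nonempty
  vertex set.
\<close>

text \<open>
  The library's \<open>forest\<close> and \<open>tree\<close> are unsuitable for symmetric digraphs, since there the
  closed walk \<open>u, v, u\<close> along a single edge counts as a cycle.  An undirected cycle is a cycle
  with at least three arcs.
\<close>

definition simple_tree :: "'a pair_pre_digraph \<Rightarrow> bool" where
  "simple_tree T \<longleftrightarrow> pair_graph T \<and> Digraph_Component.connected (with_proj T) \<and>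
     \<not> (\<exists>p. pre_digraph.cycle (with_proj T) p \<and> 3 \<le> length p)"

definition delete_vertex :: "'a pair_pre_digraph \<Rightarrow> 'a \<Rightarrow> 'a pair_pre_digraph" where
  "delete_vertex G v =
     \<lparr> pverts = pverts G - {v}, parcs = {a \<in> parcs G. fst a \<noteq> v \<and> snd a \<noteq> v} \<rparr>"

definition delete_edge :: "'a pair_pre_digraph \<Rightarrow> 'a \<Rightarrow> 'a \<Rightarrow> 'a pair_pre_digraph" where
  "delete_edge G u v = \<lparr> pverts = pverts G, parcs = parcs G - {(u, v), (v, u)} \<rparr>"

text \<open>
  Contraction of the edge \<open>uv\<close>: the merged vertex keeps the name \<open>u\<close>; loops are removed, and
  parallel edges are identified because arcs form a set.
\<close>

definition contract_edge :: "'a pair_pre_digraph \<Rightarrow> 'a \<Rightarrow> 'a \<Rightarrow> 'a pair_pre_digraph" where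
  "contract_edge G u v =
     (let f = (\<lambda>x. if x = v then u else x)
      in \<lparr> pverts = f ` pverts G, parcs = map_prod f f ` parcs G - Id \<rparr>)"

inductive minor_step :: "'a pair_pre_digraph \<Rightarrow> 'a pair_pre_digraph \<Rightarrow> bool" where
  vertex_deletion: "v \<in> pverts G \<Longrightarrow> minor_step G (delete_vertex G v)"
| edge_deletion: "(u, v) \<in> parcs G \<Longrightarrow> minor_step G (delete_edge G u v)"
| edge_contraction: "(u, v) \<in> parcs G \<Longrightarrow> minor_step G (contract_edge G u v)"

text \<open>Minors are taken up to isomorphism, so the vertices of \<open>H\<close> and \<open>G\<close> may have different types.\<close>

definition is_minor :: "'b pair_pre_digraph \<Rightarrow> 'a pair_pre_digraph \<Rightarrow> bool" where
  "is_minor H G \<longleftrightarrow> (\<exists>K. minor_step\<^sup>*\<^sup>* G K \<and> digraph_iso (with_proj K) (with_proj H))"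

definition connected_minor :: "'b pair_pre_digraph \<Rightarrow> 'a pair_pre_digraph \<Rightarrow> bool" where
  "connected_minor H G \<longleftrightarrow> is_minor H G \<and> Digraph_Component.connected (with_proj H)"

text \<open>\<open>blue_at G B k\<close> is the set $B^{(k)}$ of vertices turning blue at time step \<open>k\<close>.\<close>

fun blue_at :: "'a pair_pre_digraph \<Rightarrow> 'a set \<Rightarrow> nat \<Rightarrow> 'a set" where
  "blue_at G B k =
     (if k = 0 then B
      else {v \<in> pverts G. v \<notin> (\<Union>i\<in>{..<k}. blue_at G B i) \<and>
              (\<exists>u \<in> (\<Union>i\<in>{..<k}. blue_at G B i). (u, v) \<in> parcs G)})"

declare blue_at.simps [simp del]

definition full_pt :: "'a pair_pre_digraph \<Rightarrow> 'a set \<Rightarrow> enat" where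
  "full_pt G B =
     (if \<exists>k. (\<Union>i\<in>{..k}. blue_at G B i) = pverts G
      then enat (LEAST k. (\<Union>i\<in>{..k}. blue_at G B i) = pverts G)
      else \<infinity>)"

definition full_th_of :: "'a pair_pre_digraph \<Rightarrow> 'a set \<Rightarrow> enat" where
  "full_th_of G B = enat (card B) + full_pt G B"

definition full_th :: "'a pair_pre_digraph \<Rightarrow> enat" where
  "full_th G = Min (full_th_of G ` Pow (pverts G))"

end

theory Submission
  imports Defs
begin

text \<open>
  Write \<open>C\<^sub>k\<close> for the set of vertices that are blue after \<open>k\<close> steps.  If \<open>g\<close> maps the vertices
  of \<open>G\<close> onto those of \<open>H\<close> and sends the ends of every edge to equal or adjacent vertices, then
  distances do not grow under \<open>g\<close>, so \<open>g ` C\<^sub>k\<close> is blue by step \<open>k\<close> when \<open>H\<close> is started from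
  \<open>g ` B\<close>.  Since \<open>g ` B\<close> is no larger than \<open>B\<close>, the throttling number of \<open>H\<close> is at most that of
  \<open>G\<close> (lemma \<open>full_th_le_if_surj_weak_hom\<close>).

  It remains to find such a map from a tree \<open>T\<close> onto any connected minor \<open>T'\<close>.  A minor comes with
  branch sets: the fibres of a map \<open>f\<close> from a set \<open>S\<close> of vertices of \<open>T\<close> onto the vertices of
  \<open>T'\<close>, each connected inside \<open>T\<close>, such that each edge of \<open>T'\<close> is the image of an edge of
  \<open>T\<close> (lemma \<open>branch_model_if_is_minor\<close>).  Contract \<^emph>\<open>every\<close> edge of \<open>T\<close> that does not lift
  an edge of \<open>T'\<close>, also those outside \<open>S\<close>.  No two branch sets are merged by this: if two
  were, follow a walk of \<open>T'\<close> from one to the other that never returns to its start.  The lift of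
  its first edge \<open>uv\<close> would be bypassed by the remainder of the lifted walk and the contracted
  edges, and so would lie on a cycle of the tree
  (lemma \<open>non_lifts_stay_in_branch_set\<close>).  Because \<open>T\<close> is connected, each of its vertices
  is contracted into some branch set, and this assignment is the required map.
\<close>

section \<open>Throttling under weak homomorphisms\<close>

text \<open>
  These cumulative sets are easier to handle than the sets of vertices that turn blue exactly at
  step \<open>k\<close>: they obey a recursion that looks back one step only, and they can be compared
  between graphs, since the image of a vertex may turn blue earlier than the vertex itself.
\<close>

definition blue_by :: "'a pair_pre_digraph \<Rightarrow> 'a set \<Rightarrow> nat \<Rightarrow> 'a set" where
  "blue_by G B k = (\<Union>i\<in>{..k}. blue_at G B i)"

lemma blue_by_0: "blue_by G B 0 = B"
  by (simp add: blue_by_def blue_at.simps[of _ _ 0])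

lemma blue_by_Suc:
  "blue_by G B (Suc k) =
     blue_by G B k \<union> {v \<in> pverts G. \<exists>u \<in> blue_by G B k. (u, v) \<in> parcs G}"
proof -
  have "blue_by G B (Suc k) = blue_by G B k \<union> blue_at G B (Suc k)"
    by (auto simp: blue_by_def atMost_Suc)
  also have "blue_at G B (Suc k) = {v \<in> pverts G. v \<notin> blue_by G B k \<and>
      (\<exists>u \<in> blue_by G B k. (u, v) \<in> parcs G)}"
    by (subst blue_at.simps) (simp add: blue_by_def lessThan_Suc_atMost)
  finally show ?thesis by auto
qed

lemma blue_by_subset: "B \<subseteq> pverts G \<Longrightarrow> blue_by G B k \<subseteq> pverts G"
  by (induction k) (auto simp: blue_by_0 blue_by_Suc)

lemma full_pt_le_iff:
  assumes "B \<subseteq> pverts G"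
  shows "full_pt G B \<le> enat k \<longleftrightarrow> blue_by G B k = pverts G"
proof
  let ?P = "\<lambda>k. blue_by G B k = pverts G"
  assume le: "full_pt G B \<le> enat k"
  then have ex: "\<exists>k. ?P k"
    by (auto simp: full_pt_def blue_by_def split: if_splits)
  then have "(LEAST k. ?P k) \<le> k"
    using le by (simp add: full_pt_def flip: blue_by_def)
  moreover have "?P (LEAST k. ?P k)" using ex by (rule LeastI_ex)
  moreover have "blue_by G B i \<subseteq> blue_by G B j" if "i \<le> j" for i j
    unfolding blue_by_def using that by (intro UN_mono) auto
  ultimately show "?P k" using blue_by_subset[OF assms, of k] by blast
next
  assume "blue_by G B k = pverts G"
  then show "full_pt G B \<le> enat k"
    by (auto simp: full_pt_def simp flip: blue_by_def intro: Least_le)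
qed

text \<open>
  When \<open>u\<close> turns its neighbour \<open>v\<close> blue in \<open>G\<close>, either \<open>g v = g u\<close> is blue in \<open>H\<close>
  already, or \<open>g u\<close> forces \<open>g v\<close> to be blue after the same step.
\<close>

lemma image_blue_by_subset:
  assumes hom: "\<And>x y. (x, y) \<in> parcs G \<Longrightarrow> g x = g y \<or> (g x, g y) \<in> parcs H"
    and img: "g ` pverts G \<subseteq> pverts H"
  shows "g ` blue_by G B k \<subseteq> blue_by H (g ` B) k"
proof (induction k)
  case 0
  show ?case by (simp add: blue_by_0)
next
  case (Suc k)
  have "g v \<in> blue_by H (g ` B) (Suc k)"
    if "v \<in> pverts G" "u \<in> blue_by G B k" "(u, v) \<in> parcs G" for u v
  proof -
    have "g u \<in> blue_by H (g ` B) k" using Suc that(2) by blast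
    moreover have "g v \<in> pverts H" using img that(1) by blast
    moreover have "g u = g v \<or> (g u, g v) \<in> parcs H" using hom that(3) by blast
    ultimately show ?thesis unfolding blue_by_Suc by fastforce
  qed
  moreover have "g ` blue_by G B k \<subseteq> blue_by H (g ` B) (Suc k)"
    using Suc unfolding blue_by_Suc by blast
  ultimately show ?case unfolding blue_by_Suc[of G] by blast
qed

lemma full_th_le_if_surj_weak_hom:
  assumes fin: "finite (pverts G)"
    and hom: "\<And>x y. (x, y) \<in> parcs G \<Longrightarrow> g x = g y \<or> (g x, g y) \<in> parcs H"
    and surj: "g ` pverts G = pverts H"
  shows "full_th H \<le> full_th G"
proof -
  have finH: "finite (pverts H)" using fin surj by (metis finite_imageI)
  have "full_th H \<le> full_th_of G B" if B: "B \<subseteq> pverts G" for B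
  proof -
    have gB: "g ` B \<subseteq> pverts H" using B surj by blast
    have "full_pt H (g ` B) \<le> full_pt G B"
    proof (cases "full_pt G B")
      case (enat k)
      then have "blue_by G B k = pverts G" using full_pt_le_iff[OF B, of k] by simp
      then have "pverts H \<subseteq> blue_by H (g ` B) k"
        using image_blue_by_subset[of G g H, OF hom, of B k] surj by simp
      then have "blue_by H (g ` B) k = pverts H" using blue_by_subset[OF gB] by blast
      then show ?thesis using full_pt_le_iff[OF gB, of k] enat by simp
    qed simp
    moreover have "card (g ` B) \<le> card B"
      using B fin by (meson card_image_le finite_subset)
    ultimately have "full_th_of H (g ` B) \<le> full_th_of G B"
      unfolding full_th_of_def by (simp add: add_mono)
    moreover have "full_th H \<le> full_th_of H (g ` B)"
      unfolding full_th_def using finH gB by (intro Min_le) auto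
    ultimately show ?thesis by (rule order_trans[rotated])
  qed
  then show ?thesis
    unfolding full_th_def[of G] using fin by (subst Min_ge_iff) auto
qed

section \<open>Branch sets of a minor\<close>

text \<open>
  Branch sets are encoded as the fibres of one map, which makes their disjointness automatic.
  The third conjunct demands that each fibre is connected by arcs inside itself.  An arc of \<open>G\<close>
  between two fibres need not come from an arc of \<open>K\<close>, since edges may have been deleted.
\<close>

definition branch_model ::
  "'a pair_pre_digraph \<Rightarrow> 'a set \<Rightarrow> ('a \<Rightarrow> 'b) \<Rightarrow> 'b pair_pre_digraph \<Rightarrow> bool" where
  "branch_model G S f K \<longleftrightarrow>
     S \<subseteq> pverts G \<and> f ` S = pverts K \<and>
     (\<forall>s\<in>S. \<forall>t\<in>S. f s = f t \<longrightarrow>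
        (s, t) \<in> {(x, y) \<in> parcs G. x \<in> S \<and> y \<in> S \<and> f x = f y}\<^sup>*) \<and>
     (\<forall>a b. (a, b) \<in> parcs K \<longrightarrow> (\<exists>x\<in>S. \<exists>y\<in>S. (x, y) \<in> parcs G \<and> f x = a \<and> f y = b))"

lemma branch_modelI:
  assumes "S \<subseteq> pverts G" "f ` S = pverts K"
    and "\<And>s t. s \<in> S \<Longrightarrow> t \<in> S \<Longrightarrow> f s = f t \<Longrightarrow>
      (s, t) \<in> {(x, y) \<in> parcs G. x \<in> S \<and> y \<in> S \<and> f x = f y}\<^sup>*"
    and "\<And>a b. (a, b) \<in> parcs K \<Longrightarrow> \<exists>x\<in>S. \<exists>y\<in>S. (x, y) \<in> parcs G \<and> f x = a \<and> f y = b"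
  shows "branch_model G S f K"
  using assms unfolding branch_model_def by blast

lemma branch_modelD:
  assumes "branch_model G S f K"
  shows "S \<subseteq> pverts G" "f ` S = pverts K"
    and "s \<in> S \<Longrightarrow> t \<in> S \<Longrightarrow> f s = f t \<Longrightarrow>
      (s, t) \<in> {(x, y) \<in> parcs G. x \<in> S \<and> y \<in> S \<and> f x = f y}\<^sup>*"
    and "(a, b) \<in> parcs K \<Longrightarrow> \<exists>x\<in>S. \<exists>y\<in>S. (x, y) \<in> parcs G \<and> f x = a \<and> f y = b"
  using assms unfolding branch_model_def by blast+

lemma branch_model_delete_vertex:
  assumes "branch_model G S f K"
  shows "branch_model G {s \<in> S. f s \<noteq> v} f (delete_vertex K v)"
proof -
  show ?thesis
  proof (rule branch_modelI)
    show "{s \<in> S. f s \<noteq> v} \<subseteq> pverts G" using branch_modelD(1)[OF assms] by blast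
    show "f ` {s \<in> S. f s \<noteq> v} = pverts (delete_vertex K v)"
      using branch_modelD(2)[OF assms] by (auto simp: delete_vertex_def)
  next
    fix s t assume "s \<in> {s \<in> S. f s \<noteq> v}" "t \<in> {s \<in> S. f s \<noteq> v}" "f s = f t"
    then have "(s, t) \<in> {(x, y) \<in> parcs G. x \<in> S \<and> y \<in> S \<and> f x = f y}\<^sup>*" "f t \<noteq> v"
      using branch_modelD(3)[OF assms, of s t] by blast+
    then have "(s, t) \<in> {(x, y) \<in> parcs G.
        x \<in> {s \<in> S. f s \<noteq> v} \<and> y \<in> {s \<in> S. f s \<noteq> v} \<and> f x = f y}\<^sup>* \<and> f s = f t"
    proof (induction rule: converse_rtrancl_induct)
      case (step x y)
      then show ?case by (intro conjI converse_rtrancl_into_rtrancl[of x y]) auto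
    qed simp
    then show "(s, t) \<in> {(x, y) \<in> parcs G.
        x \<in> {s \<in> S. f s \<noteq> v} \<and> y \<in> {s \<in> S. f s \<noteq> v} \<and> f x = f y}\<^sup>*" ..
  next
    fix a b assume "(a, b) \<in> parcs (delete_vertex K v)"
    then have "(a, b) \<in> parcs K" "a \<noteq> v" "b \<noteq> v" by (auto simp: delete_vertex_def)
    then show "\<exists>x\<in>{s \<in> S. f s \<noteq> v}. \<exists>y\<in>{s \<in> S. f s \<noteq> v}.
        (x, y) \<in> parcs G \<and> f x = a \<and> f y = b"
      using branch_modelD(4)[OF assms, of a b] by blast
  qed
qed

lemma branch_model_delete_edge:
  assumes "branch_model G S f K"
  shows "branch_model G S f (delete_edge K u v)"
  using branch_modelD[OF assms] by (intro branch_modelI) (simp_all add: delete_edge_def)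

text \<open>The two branch sets that merge are joined by the lift of the contracted edge.\<close>

lemma branch_model_contract_edge:
  assumes sym: "sym (parcs G)" and model: "branch_model G S f K" and uv: "(u, v) \<in> parcs K"
  shows "branch_model G S ((\<lambda>x. if x = v then u else x) \<circ> f) (contract_edge K u v)"
proof -
  define c where "c = (\<lambda>x. if x = v then u else x)"
  define F where "F = {(x, y) \<in> parcs G. x \<in> S \<and> y \<in> S \<and> f x = f y}"
  define F' where "F' = {(x, y) \<in> parcs G. x \<in> S \<and> y \<in> S \<and> c (f x) = c (f y)}"
  have "F\<^sup>* \<subseteq> F'\<^sup>*" by (rule rtrancl_mono) (auto simp: F_def F'_def)
  then have fib: "(s, t) \<in> F'\<^sup>*" if "s \<in> S" "t \<in> S" "f s = f t" for s t
    using branch_modelD(3)[OF model that] unfolding F_def by blast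
  obtain p q where pq: "p \<in> S" "q \<in> S" "(p, q) \<in> parcs G" "f p = u" "f q = v"
    using branch_modelD(4)[OF model uv] by blast
  have F'pq: "(p, q) \<in> F'" "(q, p) \<in> F'"
    using pq symD[OF sym] by (auto simp: F'_def c_def)
  have "(s, t) \<in> F'\<^sup>*" if st: "s \<in> S" "t \<in> S" "c (f s) = c (f t)" for s t
  proof -
    consider "f s = f t" | "f s = u" "f t = v" | "f s = v" "f t = u"
      using st(3) by (auto simp: c_def split: if_splits)
    then show ?thesis
    proof cases
      case 1
      then show ?thesis using fib st by blast
    next
      case 2
      then have "(s, p) \<in> F'\<^sup>*" "(q, t) \<in> F'\<^sup>*" using fib st pq by auto
      then show ?thesis using F'pq(1) by (meson rtrancl.rtrancl_into_rtrancl rtrancl_trans)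
    next
      case 3
      then have "(s, q) \<in> F'\<^sup>*" "(p, t) \<in> F'\<^sup>*" using fib st pq by auto
      then show ?thesis using F'pq(2) by (meson rtrancl.rtrancl_into_rtrancl rtrancl_trans)
    qed
  qed
  then have fib': "(s, t) \<in> {(x, y) \<in> parcs G. x \<in> S \<and> y \<in> S \<and> (c \<circ> f) x = (c \<circ> f) y}\<^sup>*"
    if "s \<in> S" "t \<in> S" "(c \<circ> f) s = (c \<circ> f) t" for s t
    using that by (simp add: F'_def)
  have contract: "contract_edge K u v = \<lparr>pverts = c ` pverts K, parcs = map_prod c c ` parcs K - Id\<rparr>"
    by (simp only: contract_edge_def Let_def c_def)
  have "branch_model G S (c \<circ> f) (contract_edge K u v)"
  proof (rule branch_modelI[OF branch_modelD(1)[OF model] _ fib'])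
    show "(c \<circ> f) ` S = pverts (contract_edge K u v)"
      unfolding contract pair_pre_digraph.simps branch_modelD(2)[OF model, symmetric]
      by (rule image_comp[symmetric])
  next
    fix a b assume "(a, b) \<in> parcs (contract_edge K u v)"
    then obtain a' b' where "(a', b') \<in> parcs K" "a = c a'" "b = c b'"
      by (auto simp: contract)
    then show "\<exists>x\<in>S. \<exists>y\<in>S. (x, y) \<in> parcs G \<and> (c \<circ> f) x = a \<and> (c \<circ> f) y = b"
      using branch_modelD(4)[OF model, of a' b'] by auto
  qed
  then show ?thesis by (simp add: c_def)
qed

lemma branch_model_iso:
  assumes model: "branch_model G S f K" and iso: "digraph_iso (with_proj K) (with_proj H)"
  shows "\<exists>f'. branch_model G S f' H"
proof -
  obtain h where h: "pre_digraph.digraph_isomorphism (with_proj K) h"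
    and H: "with_proj H = app_iso h (with_proj K)"
    using iso unfolding digraph_iso_def by blast
  have wf: "wf_digraph (with_proj K)" using h by (simp add: pre_digraph.digraph_isomorphism_def)
  define i where "i = iso_verts h"
  have V: "pverts H = i ` pverts K"
    using arg_cong[OF H, of verts] by (simp add: i_def)
  have E: "parcs H = (\<lambda>(x, y). (i x, i y)) ` parcs K"
    using arg_cong[OF H, of arcs_ends] wf_digraph.arcs_ends_app_iso_eq[OF wf h] by (simp add: i_def)
  have "inj_on i (pverts K)"
    using pre_digraph.digraph_isomorphism_inj_on_verts[OF h] by (simp add: i_def)
  then have inj: "i (f s) = i (f t) \<longleftrightarrow> f s = f t" if "s \<in> S" "t \<in> S" for s t
    using that branch_modelD(2)[OF model] by (metis imageI inj_on_eq_iff)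
  then have fibres: "{(x, y) \<in> parcs G. x \<in> S \<and> y \<in> S \<and> (i \<circ> f) x = (i \<circ> f) y} =
      {(x, y) \<in> parcs G. x \<in> S \<and> y \<in> S \<and> f x = f y}" by auto
  have "branch_model G S (i \<circ> f) H"
  proof (rule branch_modelI[OF branch_modelD(1)[OF model]], unfold fibres)
    show "(i \<circ> f) ` S = pverts H"
      unfolding V branch_modelD(2)[OF model, symmetric] by (rule image_comp[symmetric])
  next
    fix s t assume "s \<in> S" "t \<in> S" "(i \<circ> f) s = (i \<circ> f) t"
    then show "(s, t) \<in> {(x, y) \<in> parcs G. x \<in> S \<and> y \<in> S \<and> f x = f y}\<^sup>*"
      using branch_modelD(3)[OF model, of s t] inj by simp
  next
    fix a b assume "(a, b) \<in> parcs H"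
    then obtain a' b' where "(a', b') \<in> parcs K" "a = i a'" "b = i b'"
      by (auto simp: E)
    then show "\<exists>x\<in>S. \<exists>y\<in>S. (x, y) \<in> parcs G \<and> (i \<circ> f) x = a \<and> (i \<circ> f) y = b"
      using branch_modelD(4)[OF model, of a' b'] by auto
  qed
  then show ?thesis by blast
qed

lemma branch_model_if_is_minor:
  assumes G: "pair_graph G" and "is_minor H G"
  shows "\<exists>S f. branch_model G S f H"
proof -
  interpret pair_graph G by (rule G)
  have sym: "sym (parcs G)" by (auto intro: symI arcs_symmetric)
  obtain K where K: "minor_step\<^sup>*\<^sup>* G K" "digraph_iso (with_proj K) (with_proj H)"
    using assms(2) unfolding is_minor_def by blast
  from K(1) have "\<exists>S f. branch_model G S (f :: 'a \<Rightarrow> 'a) K"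
  proof induction
    case base
    have "branch_model G (pverts G) id G"
      by (rule branch_modelI) (auto dest: in_arcsD1 in_arcsD2)
    then show ?case by blast
  next
    case (step K L)
    then obtain S and f :: "'a \<Rightarrow> 'a" where "branch_model G S f K" by blast
    with step.hyps(2) show ?case
      by cases (blast intro: branch_model_delete_vertex branch_model_delete_edge
          branch_model_contract_edge[OF sym])+
  qed
  then show ?thesis using branch_model_iso K(2) by blast
qed

section \<open>Trees\<close>

lemma rtrancl_parcs_if_connected:
  assumes "pair_graph G" "Digraph_Component.connected (with_proj G)" "x \<in> pverts G" "y \<in> pverts G"
  shows "(x, y) \<in> (parcs G)\<^sup>*"
proof -
  interpret pair_graph G by (rule assms(1))
  have "strongly_connected (with_proj G)"
    by (rule symmetric_connected_imp_strongly_connected[OF pair_sym_arcs assms(2)])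
  then have "(x, y) \<in> rtrancl_on (pverts G) (parcs G)"
    using assms(3,4) by (auto simp: strongly_connected_def reachable_def)
  then show ?thesis by (rule rtrancl_on_rtranclI)
qed

text \<open>
  A path from \<open>u\<close> to \<open>v\<close> without the edge \<open>uv\<close> has at least two arcs, so the arc \<open>(v, u)\<close>
  closes it to a cycle of length at least three.
\<close>

lemma tree_arc_is_bridge:
  assumes T: "simple_tree T" and uv: "(u, v) \<in> parcs T"
  shows "(u, v) \<notin> (parcs T - {(u, v), (v, u)})\<^sup>*"
proof
  assume walk: "(u, v) \<in> (parcs T - {(u, v), (v, u)})\<^sup>*"
  interpret T: pair_graph T using T by (simp add: simple_tree_def)
  define D where "D = delete_edge T u v"
  have parcs_D: "parcs D = parcs T - {(u, v), (v, u)}" and pverts_D: "pverts D = pverts T"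
    by (simp_all add: D_def delete_edge_def)
  interpret D: pair_wf_digraph D
    by unfold_locales (auto simp: parcs_D pverts_D dest: T.in_arcsD1 T.in_arcsD2)
  from walk have "u \<rightarrow>\<^sup>*\<^bsub>with_proj D\<^esub> v"
  proof induction
    case base
    then show ?case using uv by (simp add: pverts_D T.in_arcsD1)
  next
    case (step y z)
    then show ?case using D.reachable_adj_trans[of u y z] by (simp add: parcs_D)
  qed
  then obtain p where p: "D.apath u p v" by (auto simp: D.reachable_apath)
  have "u \<noteq> v" using T.pair_no_loops[OF uv] by simp
  then have "p \<noteq> []" using p by (auto simp: D.apath_Nil_iff)
  moreover have "\<nexists>e. p = [e]"
    using p by (auto simp: D.apath_Cons_iff D.apath_Nil_iff parcs_D)
  ultimately have "2 \<le> length p" by (cases p rule: remdups_adj.cases) auto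
  moreover have "T.awalk u p v" 
    using p by (auto simp: D.apath_def D.awalk_def T.awalk_def parcs_D pverts_D)
  then have "T.awalk v ((v, u) # p) v"
    using uv T.arcs_symmetric by (auto simp: T.awalk_Cons_iff)
  then have "T.cycle ((v, u) # p)"
    using p by (auto simp: T.cycle_def D.apath_def)
  ultimately show False using T by (force simp: simple_tree_def)
qed

text \<open>Cut the walk at its last visit to the start.\<close>

lemma rtrancl_first_step_without_return:
  assumes "(x, c) \<in> A\<^sup>*" "x \<noteq> c"
  shows "\<exists>y. (x, y) \<in> A \<and> (y, c) \<in> {(p, q) \<in> A. p \<noteq> x \<and> q \<noteq> x}\<^sup>*"
proof -
  let ?A = "{(p, q) \<in> A. p \<noteq> x \<and> q \<noteq> x}"
  have "(w, c) \<in> ?A\<^sup>* \<and> w \<noteq> x \<or> (\<exists>y. (x, y) \<in> A \<and> (y, c) \<in> ?A\<^sup>*)" if "(w, c) \<in> A\<^sup>*" for w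
    using that
  proof (induction rule: converse_rtrancl_induct)
    case base
    show ?case using assms(2) by auto
  next
    case (step w w')
    show ?case
    proof (cases "\<exists>y. (x, y) \<in> A \<and> (y, c) \<in> ?A\<^sup>*")
      case False
      then have w': "(w', c) \<in> ?A\<^sup>*" "w' \<noteq> x" using step.IH by auto
      with False step.hyps(1) have "w \<noteq> x" by blast
      then show ?thesis
        using w' step.hyps(1) by (intro disjI1 conjI converse_rtrancl_into_rtrancl[of w w']) auto
    qed blast
  qed
  from this[OF assms(1)] show ?thesis by blast
qed

section \<open>Extending the branch sets of a tree to all vertices\<close>

text \<open>
  These are the arcs to be contracted: those inside a branch set, those between branch sets
  whose image is not an edge of \<open>K\<close>, and those with an end outside all branch sets.
\<close>

definition non_lifts ::
  "'a pair_pre_digraph \<Rightarrow> 'a set \<Rightarrow> ('a \<Rightarrow> 'b) \<Rightarrow> 'b pair_pre_digraph \<Rightarrow> 'a rel" where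
  "non_lifts G S f K = {(x, y) \<in> parcs G. \<not> (x \<in> S \<and> y \<in> S \<and> (f x, f y) \<in> parcs K)}"

text \<open>
  If non-lifts joined two branch sets, this connection would compete with the one through
  the edges of \<open>H\<close>.  The latter can be chosen to cross a certain edge \<open>uv\<close> of the tree
  just once, at its start; going along the rest of it and back along the non-lifts then
  connects the ends of \<open>uv\<close> without using \<open>uv\<close>, although \<open>uv\<close> is a bridge.
\<close>

lemma non_lifts_stay_in_branch_set:
  assumes T: "simple_tree T" and H: "pair_graph H"
    and conn: "Digraph_Component.connected (with_proj H)"
    and model: "branch_model T S f H"
    and st: "s \<in> S" "t \<in> S" "(s, t) \<in> (non_lifts T S f H)\<^sup>*"
  shows "f s = f t"
proof (rule ccontr)
  assume neq: "f s \<noteq> f t"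
  interpret T: pair_graph T using T by (simp add: simple_tree_def)
  interpret H: pair_graph H by (rule H)
  define F where "F = {(x, y) \<in> parcs T. x \<in> S \<and> y \<in> S \<and> f x = f y}"
  define N where "N = {(p, q) \<in> parcs H. p \<noteq> f s \<and> q \<noteq> f s}"
  have img: "f ` S = pverts H"
    and fib: "\<And>x y. x \<in> S \<Longrightarrow> y \<in> S \<Longrightarrow> f x = f y \<Longrightarrow> (x, y) \<in> F\<^sup>*"
    and lift: "\<And>a b. (a, b) \<in> parcs H \<Longrightarrow>
      \<exists>x\<in>S. \<exists>y\<in>S. (x, y) \<in> parcs T \<and> f x = a \<and> f y = b"
    using branch_modelD(2-4)[OF model] unfolding F_def by blast+
  have "(f s, f t) \<in> (parcs H)\<^sup>*"
    using rtrancl_parcs_if_connected[OF H conn] img st by blast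
  then obtain b where b: "(f s, b) \<in> parcs H" "(b, f t) \<in> N\<^sup>*"
    using rtrancl_first_step_without_return[of "f s" "f t"] neq unfolding N_def by blast
  obtain u v where uv: "u \<in> S" "v \<in> S" "(u, v) \<in> parcs T" "f u = f s" "f v = b"
    using lift[OF b(1)] by blast
  have b_neq: "b \<noteq> f s" using H.pair_no_loops[OF b(1)] by simp

  define Q where "Q = parcs T - {(u, v), (v, u)}"
  have "sym Q" unfolding Q_def by (auto intro!: symI T.arcs_symmetric)
  then have symQ: "sym (Q\<^sup>*)" by (rule sym_rtrancl)
  have "F \<subseteq> Q" using uv b_neq by (auto simp: F_def Q_def)
  then have fibQ: "(x, y) \<in> Q\<^sup>*" if "x \<in> S" "y \<in> S" "f x = f y" for x y
    using fib[OF that] rtrancl_mono by blast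
  have "non_lifts T S f H \<subseteq> Q"
    using uv b(1) H.arcs_symmetric[OF b(1)] by (auto simp: non_lifts_def Q_def)
  then have "(s, t) \<in> Q\<^sup>*" using st(3) rtrancl_mono by blast
  \<comment> \<open>A walk in \<open>N\<close> stays away from \<open>f s\<close>, so its lift never enters the branch set of \<open>u\<close>
    and cannot use the edge \<open>uv\<close>.\<close>
  moreover have "(x, t) \<in> Q\<^sup>*" if "x \<in> S" "(f x, f t) \<in> N\<^sup>*" for x
  proof -
    have "\<forall>x\<in>S. f x = a \<longrightarrow> (x, t) \<in> Q\<^sup>*" if "(a, f t) \<in> N\<^sup>*" for a
      using that
    proof (induction rule: converse_rtrancl_induct)
      case base
      show ?case using fibQ st by blast
    next
      case (step a a')
      obtain y z where yz: "y \<in> S" "z \<in> S" "(y, z) \<in> parcs T" "f y = a" "f z = a'"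
        using lift step.hyps(1) unfolding N_def by blast
      have "(y, z) \<in> Q" using yz step.hyps(1) uv(4) by (auto simp: Q_def N_def)
      moreover have "(z, t) \<in> Q\<^sup>*" using step.IH yz by blast
      ultimately have "(y, t) \<in> Q\<^sup>*" by (rule converse_rtrancl_into_rtrancl)
      then show ?case using fibQ yz by (meson rtrancl_trans)
    qed
    then show ?thesis using that by blast
  qed
  then have "(v, t) \<in> Q\<^sup>*" using uv b(2) by blast
  moreover have "(u, s) \<in> Q\<^sup>*" using fibQ uv st by blast
  ultimately have "(u, v) \<in> Q\<^sup>*" using symD[OF symQ] by (meson rtrancl_trans)
  then show False using tree_arc_is_bridge[OF T uv(3)] by (simp add: Q_def)
qed

text \<open>
  The map sends a vertex to the branch set that it reaches along non-lifts.  The ends of a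
  non-lift reach the same branch set, and the ends of any other arc lie in \<open>S\<close>, where the arc
  lifts one of \<open>H\<close>.
\<close>

lemma surj_weak_hom_onto_connected_minor:
  assumes T: "simple_tree T" and H: "pair_graph H" and minor: "connected_minor H T"
  obtains g where "\<And>x y. (x, y) \<in> parcs T \<Longrightarrow> g x = g y \<or> (g x, g y) \<in> parcs H"
    and "g ` pverts T = pverts H"
proof -
  have PT: "pair_graph T" and connT: "Digraph_Component.connected (with_proj T)"
    using T by (simp_all add: simple_tree_def)
  interpret T: pair_graph T by (rule PT)
  interpret H: pair_graph H by (rule H)
  have connH: "Digraph_Component.connected (with_proj H)"
    using minor by (simp add: connected_minor_def)
  have "is_minor H T" using minor by (simp add: connected_minor_def)
  then obtain S f where model: "branch_model T S f H"
    using branch_model_if_is_minor[OF PT] by metis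
  have ST: "S \<subseteq> pverts T" and img: "f ` S = pverts H"
    using model by (auto simp: branch_model_def)
  have "pverts H \<noteq> {}" using connH by (simp add: connected_def strongly_connected_def)
  then obtain s0 where s0: "s0 \<in> S" using img by blast
  define R where "R = non_lifts T S f H"
  have "sym R"
  proof (rule symI)
    fix x y assume "(x, y) \<in> R"
    then show "(y, x) \<in> R"
      using T.arcs_symmetric[of x y] H.arcs_symmetric[of "f y" "f x"]
      unfolding R_def non_lifts_def by blast
  qed
  then have symR: "sym (R\<^sup>*)" by (rule sym_rtrancl)

  \<comment> \<open>A walk to \<open>S\<close> uses only non-lifts before it first meets \<open>S\<close>.\<close>
  have reach: "\<exists>s\<in>S. (x, s) \<in> R\<^sup>*" if "x \<in> pverts T" for x
  proof -
    have "(x, s0) \<in> (parcs T)\<^sup>*"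
      using rtrancl_parcs_if_connected[OF PT connT] that s0 ST by blast
    then show ?thesis
    proof (induction rule: converse_rtrancl_induct)
      case base
      show ?case using s0 by blast
    next
      case (step x y)
      show ?case
      proof (cases "x \<in> S")
        case False
        then have "(x, y) \<in> R" using step.hyps(1) by (simp add: R_def non_lifts_def)
        then show ?thesis using step.IH by (meson converse_rtrancl_into_rtrancl)
      qed blast
    qed
  qed
  define g where "g x = f (SOME s. s \<in> S \<and> (x, s) \<in> R\<^sup>*)" for x
  have g_eq: "g x = f s" if "s \<in> S" "(x, s) \<in> R\<^sup>*" for x s
  proof -
    let ?r = "SOME s. s \<in> S \<and> (x, s) \<in> R\<^sup>*"
    have r: "?r \<in> S \<and> (x, ?r) \<in> R\<^sup>*" by (rule someI[of _ s]) (use that in blast)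
    then have "(?r, s) \<in> R\<^sup>*" using that(2) symD[OF symR] by (meson rtrancl_trans)
    then show ?thesis
      using non_lifts_stay_in_branch_set[OF T H connH model] r that(1)
      unfolding R_def g_def by blast
  qed
  show thesis
  proof (rule that)
    fix x y assume xy: "(x, y) \<in> parcs T"
    show "g x = g y \<or> (g x, g y) \<in> parcs H"
    proof (cases "(x, y) \<in> R")
      case True
      obtain s where "s \<in> S" "(y, s) \<in> R\<^sup>*" using reach T.in_arcsD2[OF xy] by blast
      with True show ?thesis by (metis g_eq converse_rtrancl_into_rtrancl)
    next
      case False
      then have "x \<in> S" "y \<in> S" "(f x, f y) \<in> parcs H"
        using xy by (auto simp: R_def non_lifts_def)
      then show ?thesis by (simp add: g_eq[of x x] g_eq[of y y])
    qed
  next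
    have "g ` pverts T \<subseteq> f ` S" using reach g_eq by blast
    moreover have "f ` S \<subseteq> g ` pverts T"
    proof
      fix a assume "a \<in> f ` S"
      then obtain s where "s \<in> S" "a = f s" by blast
      then have "a = g s" "s \<in> pverts T" using g_eq[of s s] ST by auto
      then show "a \<in> g ` pverts T" by blast
    qed
    ultimately show "g ` pverts T = pverts H" using img by simp
  qed
qed

theorem theorem2p3:
  fixes T :: "'a pair_pre_digraph" and T' :: "'b pair_pre_digraph"
  assumes "simple_tree T"
    and "pair_graph T'"
    and "connected_minor T' T"
  shows "full_th T' \<le> full_th T"
proof -
  interpret pair_graph T using assms(1) by (simp add: simple_tree_def)
  obtain g where g: "\<And>x y. (x, y) \<in> parcs T \<Longrightarrow> g x = g y \<or> (g x, g y) \<in> parcs T'"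
      "g ` pverts T = pverts T'"
    using surj_weak_hom_onto_connected_minor[OF assms] by blast
  show ?thesis by (rule full_th_le_if_surj_weak_hom[OF pair_finite_verts g])
qed

end
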